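(* Let $n>0$. The set $\mathcal{DSF}(n)$ of delayed semi-Fibonacci partitions consists of the partitions $\lambda$ of $n$ into parts with (pairwise) distinct $2$-adic valuations such that, if $v_1(\lambda)$ is the largest $2$-adic valuation of parts in $\lambda$, then $\lambda$ has the part $2^{v_1(\lambda)}$ and also a part with $2$-adic valuation $v_1(\lambda)-1$.
   Context: A partition of $n$ is a weakly decreasing sequence (equivalently, a finite multiset) of positive integers with sum $n$. $\lambda\sqcup\mu$ is the partition whose multiset of parts is the multiset union of the parts of $\lambda$ and $\mu$; $2\lambda$ is obtained by doubling every part of $\lambda$; if $\lambda$ has an odd part, $\lambda^{o+2}$ is obtained by adding $2$ to the largest odd part of $\lambda$. These operations are applied elementwise to sets of partitions (giving $\emptyset$ for the empty set). The delayed semi-Fibonacci partitions are defined recursively by $\mathcal{DSF}(1)=\mathcal{DSF}(2)=\emptyset$, $\mathcal{DSF}(3)=\{(2,1)\}$, and for $n\ge2$: $\mathcal{DSF}(2n)=2\,\mathcal{DSF}(n)$ and $\mathcal{DSF}(2n+1)=\big(\mathcal{DSF}(2n)\sqcup(1)\big)\cup\mathcal{DSF}(2n-1)^{o+2}$. *)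

theory Defs
  imports "HOL-Library.Multiset" "HOL-Computational_Algebra.Primes"
begin

text \<open>Partitions are represented by the multisets of their parts.\<close>

definition partition_of :: "nat multiset \<Rightarrow> nat \<Rightarrow> bool" where
  "partition_of L n \<longleftrightarrow> (\<forall>p \<in># L. p > 0) \<and> sum_mset L = n"

definition double_parts :: "nat multiset \<Rightarrow> nat multiset" where
  "double_parts L = image_mset (\<lambda>p. 2 * p) L"

definition largest_odd_part :: "nat multiset \<Rightarrow> nat" where
  "largest_odd_part L = Max {p \<in> set_mset L. odd p}"

text \<open>Only meaningful if \<open>L\<close> has an odd part. In the recursion below it is applied only to
  partitions of odd numbers.\<close>

definition odd_plus_two :: "nat multiset \<Rightarrow> nat multiset" where
  "odd_plus_two L =
     add_mset (largest_odd_part L + 2) (L - {#largest_odd_part L#})"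

text \<open>The value at \<open>0\<close> is a convention for totality; the recursion never reaches it from a
  positive argument.\<close>

function DSF :: "nat \<Rightarrow> nat multiset set" where
  "DSF 0 = {}"
| "DSF 1 = {}"
| "DSF 2 = {}"
| "DSF 3 = {{#2, 1#}}"
| "n \<ge> 2 \<Longrightarrow> DSF (2 * n) = double_parts ` DSF n"
| "n \<ge> 2 \<Longrightarrow> DSF (2 * n + 1) =
     (\<lambda>L. L + {#1#}) ` DSF (2 * n) \<union> odd_plus_two ` DSF (2 * n - 1)"
proof goal_cases
  case (1 P x)
  have "x = 0 \<or> x = 1 \<or> x = 2 \<or> x = 3 \<or> (\<exists>n\<ge>2. x = 2 * n) \<or> (\<exists>n\<ge>2. x = 2 * n + 1)"
    by presburger
  with 1 show ?case by blast
qed (auto, (drule arg_cong[where f = even], simp)+)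
termination by (relation "measure id") auto

definition distinct_valuations :: "nat multiset \<Rightarrow> bool" where
  "distinct_valuations L \<longleftrightarrow> (\<forall>k. count (image_mset (multiplicity 2) L) k \<le> 1)"

definition max_valuation :: "nat multiset \<Rightarrow> nat" where
  "max_valuation L = Max (multiplicity 2 ` set_mset L)"

end

theory Submission
  imports Defs
begin

text \<open>
  Call the right-hand condition on a partition \<open>\<lambda>\<close> ``delayed''. The delayed partitions satisfy the
  recursion that defines \<open>DSF\<close>, so the theorem follows by the induction that comes with \<open>DSF\<close>.

  Parts with distinct valuations include at most one odd part, so the parity of \<open>n\<close> decides whether
  there is one. If \<open>n\<close> is even there is none (\<open>distinct_valuations_even_sum\<close>), and halving every
  part lowers all valuations by one, which preserves delayedness (\<open>delayed_double_parts\<close>).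

  If \<open>n\<close> is odd there is exactly one odd part \<open>p\<close> (\<open>distinct_valuations_odd_sum\<close>). A delayed
  partition has a part of positive valuation, so \<open>2 ^ v\<close> is never the odd part, and only the
  parity of \<open>p\<close> enters the condition: delayedness is a condition \<open>even_core\<close> on the remaining even
  parts alone (\<open>delayed_add_odd\<close>). Hence \<open>p \<ge> 3\<close> can be lowered by two without further
  consequences, which gives the partitions in the image of \<open>odd_plus_two\<close>. If \<open>p = 1\<close>, removing it
  leaves a delayed partition (\<open>even_core_iff_delayed\<close>), unless the part \<open>1\<close> was the required one of
  valuation \<open>v - 1\<close>. In that exceptional case \<open>v = 1\<close> and the partition is \<open>(2,1)\<close>, which is the
  initial value at \<open>3\<close>.
\<close>

section \<open>Distinct valuations\<close>

lemma distinct_valuations_empty [simp]: "distinct_valuations {#}"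
  by (simp add: distinct_valuations_def)

lemma distinct_valuations_add_mset:
  "distinct_valuations (add_mset p L) \<longleftrightarrow>
     distinct_valuations L \<and> (\<forall>q \<in># L. multiplicity 2 q \<noteq> multiplicity 2 p)"
proof
  assume *: "distinct_valuations (add_mset p L)"
  let ?V = "image_mset (multiplicity 2) L"
  have "count ?V k \<le> 1" for k
    using *[unfolded distinct_valuations_def, rule_format, of k] by (auto split: if_splits)
  moreover have "count ?V (multiplicity 2 p) = 0"
    using *[unfolded distinct_valuations_def, rule_format, of "multiplicity 2 p"] by simp
  ultimately show "distinct_valuations L \<and> (\<forall>q \<in># L. multiplicity 2 q \<noteq> multiplicity 2 p)"
    unfolding distinct_valuations_def count_eq_zero_iff set_image_mset by (metis imageI)
next
  assume *: "distinct_valuations L \<and> (\<forall>q \<in># L. multiplicity 2 q \<noteq> multiplicity 2 p)"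
  then have "count (image_mset (multiplicity 2) L) (multiplicity 2 p) = 0"
    unfolding count_eq_zero_iff by auto
  with * show "distinct_valuations (add_mset p L)"
    by (simp add: distinct_valuations_def)
qed

lemma multiplicity_two_double:
  "p > 0 \<Longrightarrow> multiplicity 2 (2 * p) = Suc (multiplicity 2 p)" for p :: nat
  by (rule multiplicity_times_same) auto

lemma multiplicity_two_eq_0_iff:
  "p > 0 \<Longrightarrow> multiplicity 2 p = 0 \<longleftrightarrow> odd p" for p :: nat
  by (simp add: multiplicity_eq_zero_iff)

lemma distinct_valuations_double_parts:
  assumes "\<forall>p \<in># L. p > 0"
  shows "distinct_valuations (double_parts L) \<longleftrightarrow> distinct_valuations L"
  using assms
  by (induction L)
    (auto simp: double_parts_def distinct_valuations_add_mset multiplicity_two_double)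

lemma even_sum_mset: "\<forall>q \<in># M. even q \<Longrightarrow> even (sum_mset M)" for M :: "nat multiset"
  by (induction M) auto

lemma distinct_valuations_add_odd:
  assumes "\<forall>q \<in># M. q > 0" "odd p"
  shows "distinct_valuations (add_mset p M) \<longleftrightarrow> distinct_valuations M \<and> (\<forall>q \<in># M. even q)"
proof -
  have "multiplicity 2 p = 0"
    using \<open>odd p\<close> by (simp add: not_dvd_imp_multiplicity_0)
  with assms show ?thesis
    by (auto simp: distinct_valuations_add_mset multiplicity_two_eq_0_iff)
qed

lemma distinct_valuations_odd_sum:
  assumes "\<forall>q \<in># L. q > 0" "distinct_valuations L" "odd (sum_mset L)"
  obtains p M where "L = add_mset p M" "odd p" "\<forall>q \<in># M. even q"
proof -
  obtain p where "p \<in># L" "odd p"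
    using even_sum_mset assms(3) by blast
  moreover from \<open>p \<in># L\<close> obtain M where "L = add_mset p M"
    by (rule mset_add)
  ultimately show ?thesis
    using assms that by (auto simp: distinct_valuations_add_odd)
qed

text \<open>An odd part would be the only one, and would make the sum odd.\<close>

lemma distinct_valuations_even_sum:
  assumes "\<forall>q \<in># L. q > 0" "distinct_valuations L" "even (sum_mset L)"
  shows "\<forall>q \<in># L. even q"
proof (rule ccontr)
  assume "\<not> (\<forall>q \<in># L. even q)"
  then obtain p M where L: "L = add_mset p M" "odd p"
    by (meson mset_add)
  with assms have "\<forall>q \<in># M. even q"
    by (simp add: distinct_valuations_add_odd)
  with L assms(3) show False
    using even_sum_mset[of M] by simp
qed

section \<open>Delayed partitions\<close>

text \<open>The maximum is replaced by a bounded witness \<open>v\<close>, and \<open>v - 1\<close> by a successor, so that neither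
  the maximum of an empty set nor truncated subtraction can arise.\<close>

definition delayed :: "nat multiset \<Rightarrow> bool" where
  "delayed L \<longleftrightarrow> (\<forall>p \<in># L. p > 0) \<and> distinct_valuations L \<and>
     (\<exists>v. 2 ^ v \<in># L \<and> (\<forall>p \<in># L. multiplicity 2 p \<le> v) \<and>
          (\<exists>p \<in># L. Suc (multiplicity 2 p) = v))"

lemma delayed_iff_max_valuation:
  "delayed L \<longleftrightarrow> (\<forall>p \<in># L. p > 0) \<and> distinct_valuations L \<and> 2 ^ max_valuation L \<in># L \<and>
     (\<exists>p \<in># L. int (multiplicity 2 p) = int (max_valuation L) - 1)"
proof -
  have max: "max_valuation L = v"
    if "2 ^ v \<in># L" "\<forall>p \<in># L. multiplicity 2 p \<le> v" for v
    unfolding max_valuation_def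
  proof (rule Max_eqI)
    have "multiplicity 2 (2 ^ v :: nat) = v"
      by simp
    with that(1) show "v \<in> multiplicity 2 ` set_mset L"
      by (metis imageI)
  qed (use that in auto)
  have bound: "\<forall>p \<in># L. multiplicity 2 p \<le> max_valuation L"
    by (simp add: max_valuation_def)
  have pred: "int a = int b - 1 \<longleftrightarrow> Suc a = b" for a b
    by linarith
  have "(\<exists>v. 2 ^ v \<in># L \<and> (\<forall>p \<in># L. multiplicity 2 p \<le> v) \<and>
            (\<exists>p \<in># L. Suc (multiplicity 2 p) = v)) \<longleftrightarrow>
        2 ^ max_valuation L \<in># L \<and> (\<exists>p \<in># L. Suc (multiplicity 2 p) = max_valuation L)"
    (is "?l \<longleftrightarrow> ?r")
  proof
    assume ?l
    then obtain v where v: "2 ^ v \<in># L" "\<forall>p \<in># L. multiplicity 2 p \<le> v"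
      "\<exists>p \<in># L. Suc (multiplicity 2 p) = v"
      by (elim exE conjE)
    from v(1,3) show ?r
      unfolding max[OF v(1,2)] ..
  next
    assume ?r
    with bound show ?l
      by (intro exI[of _ "max_valuation L"] conjI) simp_all
  qed
  then show ?thesis
    unfolding delayed_def pred by (simp only:)
qed

lemma delayed_double_parts: "delayed (double_parts L) \<longleftrightarrow> delayed L"
proof (cases "\<forall>p \<in># L. p > 0")
  case True
  have shift: "(\<exists>v. P v) \<longleftrightarrow> (\<exists>v. P (Suc v))" if "\<not> P 0" for P :: "nat \<Rightarrow> bool"
    using that by (metis not0_implies_Suc)
  \<comment> \<open>No \<open>v = 0\<close> can witness delayedness, because of the part of valuation \<open>v - 1\<close>.\<close>
  have "(\<exists>v. 2 ^ v \<in># double_parts L \<and> (\<forall>p \<in># double_parts L. multiplicity 2 p \<le> v) \<and>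
            (\<exists>p \<in># double_parts L. Suc (multiplicity 2 p) = v)) \<longleftrightarrow>
        (\<exists>v. 2 ^ Suc v \<in># double_parts L \<and> (\<forall>p \<in># double_parts L. multiplicity 2 p \<le> Suc v) \<and>
            (\<exists>p \<in># double_parts L. Suc (multiplicity 2 p) = Suc v))"
    by (rule shift) simp
  also have "\<dots> \<longleftrightarrow> (\<exists>v. 2 ^ v \<in># L \<and> (\<forall>p \<in># L. multiplicity 2 p \<le> v) \<and>
            (\<exists>p \<in># L. Suc (multiplicity 2 p) = v))"
    using True by (intro arg_cong[where f = Ex] ext)
      (auto simp: double_parts_def image_iff multiplicity_two_double)
  finally show ?thesis
    using True distinct_valuations_double_parts[OF True]
    by (simp add: delayed_def) (simp add: double_parts_def)
qed (auto simp: delayed_def double_parts_def)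

lemma sum_mset_double_parts: "sum_mset (double_parts L) = 2 * sum_mset L"
  by (induction L) (auto simp: double_parts_def)

lemma even_parts_eq_double_parts:
  assumes "\<forall>q \<in># L. even q"
  obtains M where "L = double_parts M"
proof
  have "image_mset (\<lambda>q. 2 * (q div 2)) L = image_mset id L"
    using assms by (intro image_mset_cong) auto
  then show "L = double_parts (image_mset (\<lambda>q. q div 2) L)"
    by (simp add: double_parts_def image_mset.compositionality comp_def)
qed

lemma delayed_sum_even:
  "{L. delayed L \<and> sum_mset L = 2 * n} = double_parts ` {L. delayed L \<and> sum_mset L = n}"
proof (intro equalityI subsetI)
  fix L assume "L \<in> {L. delayed L \<and> sum_mset L = 2 * n}"
  then have L: "delayed L" "sum_mset L = 2 * n"
    by auto
  then have "\<forall>q \<in># L. even q"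
    using distinct_valuations_even_sum[of L] by (simp add: delayed_def)
  then obtain M where "L = double_parts M"
    by (rule even_parts_eq_double_parts)
  with L show "L \<in> double_parts ` {L. delayed L \<and> sum_mset L = n}"
    by (simp add: delayed_double_parts sum_mset_double_parts)
qed (auto simp: delayed_double_parts sum_mset_double_parts)

section \<open>Splitting off the odd part\<close>

text \<open>The condition that a delayed partition with an odd part imposes on its even parts. The
  alternative \<open>v = 1\<close> stands for the case where the odd part itself has the required valuation
  \<open>v - 1 = 0\<close>.\<close>

definition even_core :: "nat multiset \<Rightarrow> bool" where
  "even_core M \<longleftrightarrow> (\<forall>q \<in># M. q > 0 \<and> even q) \<and> distinct_valuations M \<and>
     (\<exists>v > 0. 2 ^ v \<in># M \<and> (\<forall>q \<in># M. multiplicity 2 q \<le> v) \<and>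
          (v = 1 \<or> (\<exists>q \<in># M. Suc (multiplicity 2 q) = v)))"

text \<open>The witness \<open>v\<close> is positive, being a successor, so \<open>2 ^ v\<close> is even and lies in \<open>M\<close>. All
  odd \<open>p\<close> have the same valuation \<open>0\<close>, which is why \<open>p\<close> disappears on the right; in particular
  \<open>p\<close> and \<open>p + 2\<close> are interchangeable.\<close>

lemma delayed_add_odd:
  assumes "odd p"
  shows "delayed (add_mset p M) \<longleftrightarrow> even_core M"
proof -
  have p: "p > 0" "multiplicity 2 p = 0"
    using assms by (auto simp: odd_pos not_dvd_imp_multiplicity_0)
  have not_power: "2 ^ v \<noteq> p" if "v > 0" for v
    using assms that by auto
  have conj: "A \<and> B \<and> C \<longleftrightarrow> A' \<and> B' \<and> C'"
    if "A \<and> B \<longleftrightarrow> A' \<and> B'" "C \<longleftrightarrow> C'" for A B C A' B' C'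
    using that by blast
  have "(\<exists>v. 2 ^ v \<in># add_mset p M \<and> (\<forall>q \<in># add_mset p M. multiplicity 2 q \<le> v) \<and>
            (\<exists>q \<in># add_mset p M. Suc (multiplicity 2 q) = v)) \<longleftrightarrow>
        (\<exists>v > 0. 2 ^ v \<in># M \<and> (\<forall>q \<in># M. multiplicity 2 q \<le> v) \<and>
            (v = 1 \<or> (\<exists>q \<in># M. Suc (multiplicity 2 q) = v)))"
    using not_power p by (intro arg_cong[where f = Ex] ext) auto
  moreover have "(\<forall>q \<in># add_mset p M. 0 < q) \<and> distinct_valuations (add_mset p M) \<longleftrightarrow>
      (\<forall>q \<in># M. q > 0 \<and> even q) \<and> distinct_valuations M"
    using p(1) assms distinct_valuations_add_odd[of M p] by auto
  ultimately show ?thesis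
    unfolding delayed_def even_core_def by (intro conj)
qed

lemma even_core_sum_ge_2: "even_core M \<Longrightarrow> sum_mset M \<ge> 2"
proof -
  assume "even_core M"
  then obtain v where "v > 0" "2 ^ v \<in># M"
    by (auto simp: even_core_def)
  moreover from this obtain N where "M = add_mset (2 ^ v) N"
    by (meson mset_add)
  moreover have "(2::nat) ^ 1 \<le> 2 ^ v"
    using \<open>v > 0\<close> by (intro power_increasing) auto
  ultimately show ?thesis
    by simp
qed

lemma even_core_maximum_1:
  assumes "\<forall>q \<in># M. q > 0 \<and> even q" "distinct_valuations M"
    and "2 \<in># M" "\<forall>q \<in># M. multiplicity 2 q \<le> 1"
  shows "M = {#2#}"
proof -
  obtain N where N: "M = add_mset 2 N"
    using assms(3) by (rule mset_add)
  have "multiplicity 2 q = 1" if "q \<in># M" for q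
    using assms(1,4) that multiplicity_two_eq_0_iff[of q] by (force simp: le_Suc_eq)
  then have "N = {#}"
    using assms(2) unfolding N distinct_valuations_add_mset
    by (metis multiset_nonemptyE union_single_eq_member insert_iff set_mset_add_mset_insert)
  with N show ?thesis by simp
qed

lemma even_core_single_2: "even_core {#2#}"
proof -
  have "multiplicity 2 (2::nat) = 1"
    by (rule multiplicity_self) auto
  then show ?thesis
    by (auto simp: even_core_def distinct_valuations_add_mset intro!: exI[of _ 1])
qed

text \<open>The exceptional case \<open>v = 1\<close> of \<open>even_core\<close> allows only the single part \<open>2\<close>, which the
  condition \<open>sum_mset M \<noteq> 2\<close> excludes.\<close>

lemma even_core_iff_delayed:
  assumes "sum_mset M \<noteq> 2" "even (sum_mset M)"
  shows "even_core M \<longleftrightarrow> delayed M"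
proof
  assume "even_core M"
  then obtain v where M: "\<forall>q \<in># M. q > 0 \<and> even q" "distinct_valuations M"
    and v: "2 ^ v \<in># M" "\<forall>q \<in># M. multiplicity 2 q \<le> v"
      "v = 1 \<or> (\<exists>q \<in># M. Suc (multiplicity 2 q) = v)"
    by (auto simp: even_core_def)
  have "v \<noteq> 1"
    using even_core_maximum_1[OF M] v(1,2) assms(1) by auto
  with M v show "delayed M"
    unfolding delayed_def by blast
next
  assume "delayed M"
  moreover from this have "\<forall>q \<in># M. even q"
    using distinct_valuations_even_sum[of M] assms(2) by (simp add: delayed_def)
  ultimately show "even_core M"
    unfolding delayed_def even_core_def by (metis zero_less_Suc)
qed

lemma delayed_sum_odd:
  assumes "odd m"
  shows "{L. delayed L \<and> sum_mset L = m} =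
    {add_mset p M | p M. odd p \<and> even_core M \<and> p + sum_mset M = m}"
proof (intro equalityI subsetI)
  fix L assume "L \<in> {L. delayed L \<and> sum_mset L = m}"
  then have L: "delayed L" "sum_mset L = m"
    by auto
  then have "\<forall>q \<in># L. q > 0" "distinct_valuations L" "odd (sum_mset L)"
    using assms by (auto simp: delayed_def)
  then obtain p M where "L = add_mset p M" "odd p"
    by (rule distinct_valuations_odd_sum)
  with L show "L \<in> {add_mset p M | p M. odd p \<and> even_core M \<and> p + sum_mset M = m}"
    by (auto simp: delayed_add_odd)
qed (auto simp: delayed_add_odd)

lemma odd_plus_two_add_odd:
  assumes "odd p" "even_core M"
  shows "odd_plus_two (add_mset p M) = add_mset (p + 2) M"
proof -
  have "{q \<in> set_mset (add_mset p M). odd q} = {p}"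
    using assms by (auto simp: even_core_def)
  then have "largest_odd_part (add_mset p M) = p"
    unfolding largest_odd_part_def by (metis Max_singleton)
  then show ?thesis
    by (simp add: odd_plus_two_def)
qed

section \<open>The recursion for delayed partitions\<close>

lemma delayed_sum_1: "{L. delayed L \<and> sum_mset L = 1} = {}"
  unfolding delayed_sum_odd[OF odd_one] by (fastforce dest: even_core_sum_ge_2)

lemma delayed_sum_3: "{L. delayed L \<and> sum_mset L = 3} = {{#2, 1#}}"
proof -
  have "p = 1 \<and> M = {#2#}" if pM: "odd p" "even_core M" "p + sum_mset M = 3" for p M
  proof -
    have sum: "p = 1" "sum_mset M = 2"
      using pM odd_pos[of p] even_core_sum_ge_2[of M] by linarith+
    obtain v where v: "v > 0" "2 ^ v \<in># M"
      using pM(2) by (auto simp: even_core_def)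
    then obtain N where N: "M = add_mset (2 ^ v) N"
      by (meson mset_add)
    have "(2::nat) ^ 1 \<le> 2 ^ v"
      using v by (intro power_increasing) auto
    moreover have "2 ^ v + sum_mset N = 2"
      using sum N by simp
    ultimately have pow: "(2::nat) ^ v = 2" and "sum_mset N = 0"
      unfolding power_one_right by linarith+
    moreover have "\<forall>q \<in># N. q > 0"
      using pM(2) N by (auto simp: even_core_def)
    ultimately have "set_mset N = {}"
      by fastforce
    with sum N pow show ?thesis
      by simp
  qed
  then have "odd p \<and> even_core M \<and> p + sum_mset M = 3 \<longleftrightarrow> p = 1 \<and> M = {#2#}" for p M
    using even_core_single_2 by auto
  then have "{L. delayed L \<and> sum_mset L = 3} = {add_mset p M | p M. p = 1 \<and> M = {#2#}}"
    by (subst delayed_sum_odd) simp_all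
  then show ?thesis
    by (simp add: add_mset_commute)
qed

text \<open>The two images correspond to the partitions whose odd part is \<open>1\<close> and to those whose odd part
  is at least \<open>3\<close>. The equation fails for \<open>n = 1\<close>, since removing \<open>1\<close> from \<open>(2,1)\<close> leaves a
  partition that is not delayed.\<close>

lemma delayed_sum_odd_recursion:
  assumes "n \<ge> 2"
  shows "{L. delayed L \<and> sum_mset L = 2 * n + 1} =
    (\<lambda>L. L + {#1#}) ` {L. delayed L \<and> sum_mset L = 2 * n} \<union>
    odd_plus_two ` {L. delayed L \<and> sum_mset L = 2 * n - 1}"
    (is "?D = ?A \<union> ?B")
proof (intro equalityI subsetI)
  fix L assume "L \<in> ?D"
  then obtain p M where L: "L = add_mset p M" "odd p" "even_core M" "p + sum_mset M = 2 * n + 1"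
    by (auto simp: delayed_sum_odd)
  show "L \<in> ?A \<union> ?B"
  proof (cases "p = 1")
    case True
    with L assms have "delayed M" "sum_mset M = 2 * n"
      using even_core_iff_delayed[of M] by auto
    with L True show ?thesis by auto
  next
    case False
    with L(2) have p: "p - 2 + 2 = p" "odd (p - 2)"
      by presburger+
    with L have "L = odd_plus_two (add_mset (p - 2) M)"
      by (simp add: odd_plus_two_add_odd)
    moreover have "delayed (add_mset (p - 2) M)"
      using L(3) p(2) by (simp add: delayed_add_odd)
    moreover have "sum_mset (add_mset (p - 2) M) = 2 * n - 1"
      using L(4) p(1) by simp
    ultimately show ?thesis by blast
  qed
next
  fix L assume "L \<in> ?A \<union> ?B"
  then show "L \<in> ?D"
  proof
    assume "L \<in> ?A"
    then obtain M where "L = add_mset 1 M" "delayed M" "sum_mset M = 2 * n"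
      by auto
    with assms show ?thesis
      by (simp add: delayed_add_odd even_core_iff_delayed)
  next
    assume "L \<in> ?B"
    moreover have "odd (2 * n - 1)"
      using assms by simp
    ultimately obtain p M where "L = odd_plus_two (add_mset p M)" "odd p" "even_core M"
      "p + sum_mset M = 2 * n - 1"
      by (auto simp: delayed_sum_odd)
    with assms show ?thesis
      by (simp add: odd_plus_two_add_odd delayed_add_odd)
  qed
qed

lemma DSF_eq_delayed: "n > 0 \<Longrightarrow> DSF n = {L. delayed L \<and> sum_mset L = n}"
proof (induction n rule: DSF.induct)
  case 3
  have "{L. delayed L \<and> sum_mset L = 2 * 1} = {}"
    unfolding delayed_sum_even delayed_sum_1 by simp
  then show ?case by simp
next
  case (5 n)
  then show ?case
    using delayed_sum_even[of n] by simp
next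
  case (6 n)
  then have IH: "DSF (2 * n) = {L. delayed L \<and> sum_mset L = 2 * n}"
    "DSF (2 * n - 1) = {L. delayed L \<and> sum_mset L = 2 * n - 1}"
    by (intro 6; simp)+
  show ?case
    unfolding DSF.simps(6)[OF \<open>n \<ge> 2\<close>] IH delayed_sum_odd_recursion[OF \<open>n \<ge> 2\<close>] ..
next
  case 1
  then show ?case by simp
next
  case 2
  show ?case unfolding DSF.simps(2) delayed_sum_1 ..
next
  case 4
  show ?case unfolding DSF.simps(4) delayed_sum_3 ..
qed

theorem corollary8p3:
  fixes n :: nat
  assumes "n > 0"
  shows "DSF n =
    {L. partition_of L n \<and> distinct_valuations L \<and>
         2 ^ max_valuation L \<in># L \<and>
         (\<exists>p \<in># L. int (multiplicity 2 p) = int (max_valuation L) - 1)}"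
  unfolding DSF_eq_delayed[OF assms] delayed_iff_max_valuation partition_of_def
  by (simp only: conj_ac)

end
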